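(* Let $X$ be a metric space, let $a>b>2$ be real numbers, and let $f\colon X\to\mathbb{R}$ be a Takagi--van der Waerden function of monotonic type $(a,b)$. Then $\operatorname{Lip} f(x)=\infty$ for every non-isolated point $x$ of $X$.
   Context: The metric on $X$ is denoted $|\cdot-\cdot|_X$, and $d(x,A)=\inf_{y\in A}|x-y|_X$ for $x\in X$, $A\subseteq X$. For $\varepsilon>0$, a set $S\subseteq X$ is $\varepsilon$-separated if $|x-y|_X\ge\varepsilon$ for all distinct $x,y\in S$; it is maximal $\varepsilon$-separated if it is $\varepsilon$-separated and every $\varepsilon$-separated set $T\subseteq X$ with $S\subseteq T$ satisfies $T=S$. For $a>b>0$, a function $f\colon X\to\mathbb{R}$ is a Takagi--van der Waerden function (TW-function) of type $(a,b)$ if there is a sequence $(S_n)_{n=0}^\infty$, where each $S_n$ is a maximal $\frac1{a^n}$-separated set in $X$, such that $f(x)=\sum_{n=0}^\infty b^n d(x,S_n)$ for all $x\in X$. If moreover the sequence can be taken with $S_n\subseteq S_{n+1}$ for all $n$, then $f$ is called a TW-function of monotonic type $(a,b)$. For $f\colon X\to\mathbb{R}$ and a non-isolated point $x\in X$, the big Lipschitz derivative is $\operatorname{Lip} f(x)=\limsup_{u\to x}\frac{|f(u)-f(x)|}{|u-x|_X}\in[0,+\infty]$ (with $u\neq x$). *)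

theory Defs
  imports "HOL-Analysis.Analysis"
begin

definition separated_set :: "real \<Rightarrow> 'a::metric_space set \<Rightarrow> bool" where
  "separated_set \<epsilon> S \<longleftrightarrow> (\<forall>x\<in>S. \<forall>y\<in>S. x \<noteq> y \<longrightarrow> dist x y \<ge> \<epsilon>)"

definition maximal_separated_set :: "real \<Rightarrow> 'a::metric_space set \<Rightarrow> bool" where
  "maximal_separated_set \<epsilon> S \<longleftrightarrow>
     separated_set \<epsilon> S \<and> (\<forall>T. separated_set \<epsilon> T \<and> S \<subseteq> T \<longrightarrow> T = S)"

text \<open>The library's \<^term>\<open>infdist x {}\<close> is 0; this junk value never occurs below, since the
  underlying type is nonempty and hence a maximal separated set is nonempty.\<close>

definition TW_representation ::
    "real \<Rightarrow> real \<Rightarrow> (nat \<Rightarrow> 'a::metric_space set) \<Rightarrow> ('a \<Rightarrow> real) \<Rightarrow> bool" where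
  "TW_representation a b S f \<longleftrightarrow> b > 0 \<and> a > b \<and>
     (\<forall>n. maximal_separated_set (1 / a ^ n) (S n)) \<and>
     (\<forall>x. (\<lambda>n. b ^ n * infdist x (S n)) sums f x)"

definition TW_function :: "real \<Rightarrow> real \<Rightarrow> ('a::metric_space \<Rightarrow> real) \<Rightarrow> bool" where
  "TW_function a b f \<longleftrightarrow> (\<exists>S. TW_representation a b S f)"

definition TW_function_monotonic :: "real \<Rightarrow> real \<Rightarrow> ('a::metric_space \<Rightarrow> real) \<Rightarrow> bool" where
  "TW_function_monotonic a b f \<longleftrightarrow>
     (\<exists>S. TW_representation a b S f \<and> (\<forall>n. S n \<subseteq> S (Suc n)))"

text \<open>The filter \<^term>\<open>at x\<close> excludes the point itself. At an isolated point it is trivial and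
  the \<^const>\<open>Limsup\<close> is the junk value \<^term>\<open>- \<infinity> :: ereal\<close>.\<close>

definition big_Lip :: "('a::metric_space \<Rightarrow> real) \<Rightarrow> 'a \<Rightarrow> ereal" where
  "big_Lip f x = Limsup (at x) (\<lambda>u. ereal (\<bar>f u - f x\<bar> / dist u x))"

end

theory Submission
  imports Defs
begin

text \<open>
  If \<open>p \<in> S n\<close>, monotonicity makes all terms of the series of index at least \<open>n\<close> vanish at \<open>p\<close>,
  while the terms of index below \<open>n\<close> are jointly Lipschitz with constant less than
  \<open>b ^ n / (b - 1)\<close>. Hence \<open>f y - f p\<close> is at least
  \<open>b ^ n * d(y, S n) - b ^ n / (b - 1) * dist y p\<close>; when \<open>d(y, S n)\<close> is close to \<open>dist y p\<close> this
  is a positive multiple of \<open>b ^ n * dist y p\<close>, because \<open>b > 2\<close>. If \<open>x\<close> lies in some \<open>S m\<close>, one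
  applies this with \<open>p = x\<close> and \<open>y \<rightarrow> x\<close>; otherwise one takes \<open>y = x\<close> and \<open>p\<close> an almost nearest point
  of \<open>S n\<close>, and lets \<open>n \<rightarrow> \<infinity>\<close>.
\<close>

lemma big_Lip_eq_infinityI:
  fixes f :: "'a::metric_space \<Rightarrow> real"
  assumes "\<And>C \<delta>. \<delta> > 0 \<Longrightarrow> \<exists>u. u \<noteq> x \<and> dist u x < \<delta> \<and> \<bar>f u - f x\<bar> \<ge> C * dist u x"
  shows "big_Lip f x = \<infinity>"
proof (rule ccontr)
  assume "big_Lip f x \<noteq> \<infinity>"
  then have "big_Lip f x < \<infinity>" by simp
  then obtain C :: nat where "big_Lip f x < ereal (real C)"
    using less_PInf_Ex_of_nat by auto
  then have "\<forall>\<^sub>F u in at x. ereal (\<bar>f u - f x\<bar> / dist u x) < ereal (real C)"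
    unfolding big_Lip_def by (rule Limsup_lessD)
  then obtain \<delta> where \<delta>: "\<delta> > 0"
    "\<And>u. u \<noteq> x \<Longrightarrow> dist u x < \<delta> \<Longrightarrow> \<bar>f u - f x\<bar> / dist u x < real C"
    by (auto simp: eventually_at)
  obtain u where u: "u \<noteq> x" "dist u x < \<delta>" "\<bar>f u - f x\<bar> \<ge> real C * dist u x"
    using assms[OF \<delta>(1)] by blast
  have "real C \<le> \<bar>f u - f x\<bar> / dist u x"
    using u by (simp add: pos_le_divide_eq)
  with \<delta>(2)[OF u(1,2)] show False by simp
qed

text \<open>If no point of \<open>S\<close> were this close, adding \<open>x\<close> would keep the
  set separated, so maximality would put \<open>x\<close> itself into \<open>S\<close>.\<close>

lemma maximal_separated_set_near:
  assumes "maximal_separated_set \<epsilon> S" "\<epsilon> > 0"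
  obtains y where "y \<in> S" "dist x y < \<epsilon>"
proof (cases "\<exists>y\<in>S. dist x y < \<epsilon>")
  case False
  then have "separated_set \<epsilon> (insert x S)"
    using assms(1) by (auto simp: maximal_separated_set_def separated_set_def dist_commute not_less)
  then have "x \<in> S"
    using assms(1) unfolding maximal_separated_set_def by blast
  with False assms(2) show ?thesis by auto
qed (use that in auto)

lemma separated_set_closed:
  assumes "separated_set \<epsilon> S" "\<epsilon> > 0"
  shows "closed S"
  by (rule discrete_imp_closed[OF assms(2)])
    (use assms(1) in \<open>auto simp: separated_set_def dist_commute not_less[symmetric]\<close>)

text \<open>Any other point of \<open>S\<close> is at least \<open>\<epsilon>\<close> away from
  \<open>x\<close>, hence at least \<open>\<epsilon> / 2\<close> away from \<open>u\<close>.\<close>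

lemma infdist_separated_set_eq_dist:
  assumes "separated_set \<epsilon> S" "x \<in> S" "dist u x \<le> \<epsilon> / 2"
  shows "infdist u S = dist u x"
proof (rule antisym[OF infdist_le[OF assms(2)]])
  have "dist u x \<le> dist u y" if "y \<in> S" for y
  proof (cases "y = x")
    case False
    then have "\<epsilon> \<le> dist x y"
      using assms that by (auto simp: separated_set_def)
    also have "\<dots> \<le> dist u x + dist u y"
      by (rule dist_triangle3)
    finally show ?thesis using assms(3) by simp
  qed simp
  then show "dist u x \<le> infdist u S"
    using assms(2) by (auto simp: infdist_def intro: cINF_greatest)
qed

lemma infdist_near_point:
  assumes "S \<noteq> {}" "infdist x S < r"
  obtains y where "y \<in> S" "dist x y < r"
  using assms by (auto simp: infdist_def cINF_less_iff)

text \<open>Each \<open>infdist _ (S k)\<close> is 1-Lipschitz, and the weights sum to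
  \<open>(b ^ n - 1) / (b - 1)\<close>.\<close>

lemma partial_sum_infdist_diff_le:
  assumes "b > (1::real)"
  shows "(\<Sum>k<n. b ^ k * infdist p (S k)) - (\<Sum>k<n. b ^ k * infdist y (S k))
    \<le> b ^ n / (b - 1) * dist y p"
proof -
  have "(\<Sum>k<n. b ^ k * infdist p (S k)) - (\<Sum>k<n. b ^ k * infdist y (S k))
    = (\<Sum>k<n. b ^ k * (infdist p (S k) - infdist y (S k)))"
    by (simp add: sum_subtractf right_diff_distrib)
  also have "\<dots> \<le> (\<Sum>k<n. b ^ k * dist y p)"
  proof (intro sum_mono mult_left_mono)
    show "infdist p (S k) - infdist y (S k) \<le> dist y p" for k
      using infdist_triangle[of p "S k" y] by (simp add: dist_commute)
  qed (use assms in auto)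
  also have "\<dots> = (\<Sum>k<n. b ^ k) * dist y p"
    by (simp add: sum_distrib_right)
  also have "\<dots> \<le> b ^ n / (b - 1) * dist y p"
    using assms by (intro mult_right_mono) (auto simp: geometric_sum divide_right_mono)
  finally show ?thesis .
qed

text \<open>The threshold \<open>b / (2 * (b - 1))\<close> is the midpoint of
  \<open>1 / (b - 1)\<close> and 1. Subtracting the loss \<open>1 / (b - 1)\<close> leaves the slope
  factor \<open>(b - 2) / (2 * (b - 1))\<close>.\<close>

lemma TW_representation_growth:
  assumes "TW_representation a b S f" "b > 2" "incseq S" "p \<in> S n"
    and "infdist y (S n) \<ge> b / (2 * (b - 1)) * dist y p"
  shows "f y - f p \<ge> (b - 2) / (2 * (b - 1)) * b ^ n * dist y p"
proof -
  have sums: "(\<lambda>k. b ^ k * infdist z (S k)) sums f z" for z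
    using assms(1) by (simp add: TW_representation_def)
  have "infdist p (S k) = 0" if "k \<ge> n" for k
    using incseqD[OF assms(3) that] assms(4) by auto
  then have "(\<lambda>k. b ^ k * infdist p (S k)) sums (\<Sum>k<n. b ^ k * infdist p (S k))"
    by (intro sums_finite) auto
  with sums have fp: "f p = (\<Sum>k<n. b ^ k * infdist p (S k))"
    by (metis sums_unique2)
  have "(\<Sum>k<Suc n. b ^ k * infdist y (S k)) \<le> (\<Sum>k. b ^ k * infdist y (S k))"
    using assms(2) sums_summable[OF sums[of y]] by (intro sum_le_suminf) (auto simp: infdist_nonneg)
  then have "(\<Sum>k<Suc n. b ^ k * infdist y (S k)) \<le> f y"
    by (simp only: sums_unique[OF sums[of y], symmetric])
  then have "f y - f p \<ge> b ^ n * infdist y (S n) - b ^ n / (b - 1) * dist y p"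
    using partial_sum_infdist_diff_le[of b p S n y] assms(2) fp by simp
  moreover have "b ^ n * infdist y (S n) \<ge> b ^ n * (b / (2 * (b - 1)) * dist y p)"
    using assms(2,5) by (intro mult_left_mono) auto
  moreover have "b ^ n * (b / (2 * (b - 1)) * dist y p) - b ^ n / (b - 1) * dist y p
    = (b - 2) / (2 * (b - 1)) * b ^ n * dist y p"
    using assms(2) by (simp add: divide_simps) (simp add: algebra_simps)
  ultimately show ?thesis by linarith
qed

lemma growth_points_in_level:
  assumes "TW_representation a b S f" "b > 2" "incseq S" "\<not> x isolated_in UNIV"
    and "x \<in> S n" "\<delta> > 0"
  obtains u where "u \<noteq> x" "dist u x < \<delta>"
    "\<bar>f u - f x\<bar> \<ge> (b - 2) / (2 * (b - 1)) * b ^ n * dist u x"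
proof -
  have a: "a > 0" and sep: "separated_set (1 / a ^ n) (S n)"
    using assms(1) by (auto simp: TW_representation_def maximal_separated_set_def)
  define r where "r = min \<delta> (1 / a ^ n / 2)"
  have "r > 0" using assms(6) a by (simp add: r_def)
  then obtain u where u: "u \<noteq> x" "dist u x < r"
    using assms(4) unfolding isolated_in_dist_Ex_iff by (metis UNIV_I dist_commute)
  have "infdist u (S n) = dist u x"
    by (rule infdist_separated_set_eq_dist[OF sep assms(5)]) (use u in \<open>auto simp: r_def\<close>)
  moreover have "b / (2 * (b - 1)) * dist u x \<le> 1 * dist u x"
    using assms(2) by (intro mult_right_mono) auto
  ultimately have "f u - f x \<ge> (b - 2) / (2 * (b - 1)) * b ^ n * dist u x"
    by (intro TW_representation_growth[OF assms(1-3,5)]) auto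
  then show thesis using that[of u] u by (auto simp: r_def)
qed

lemma growth_points_off_level:
  assumes "TW_representation a b S f" "b > 2" "incseq S"
    and "x \<notin> S n"
  obtains u where "u \<noteq> x" "dist u x < 2 / a ^ n"
    "\<bar>f u - f x\<bar> \<ge> (b - 2) / (2 * (b - 1)) * b ^ n * dist u x"
proof -
  have a: "a > 0" and max: "maximal_separated_set (1 / a ^ n) (S n)"
    using assms(1) by (auto simp: TW_representation_def)
  then have cl: "closed (S n)"
    by (intro separated_set_closed[of "1 / a ^ n"]) (auto simp: maximal_separated_set_def)
  obtain z where z: "z \<in> S n" "dist x z < 1 / a ^ n"
    using maximal_separated_set_near[OF max] a by auto
  then have ne: "S n \<noteq> {}" and le: "infdist x (S n) < 1 / a ^ n"
    using infdist_le[of z "S n" x] by auto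
  \<comment> \<open>Positivity leaves room for an almost nearest point, since the infimum need not
    be attained.\<close>
  have pos: "infdist x (S n) > 0"
    using in_closed_iff_infdist_zero[OF cl ne, of x] assms(4) infdist_nonneg[of x "S n"] by linarith
  \<comment> \<open>This factor is the reciprocal of the growth threshold. Exceeding 1, it admits a
    point \<open>u\<close> of \<open>S n\<close>; being at most 2, it keeps \<open>u\<close> within
    \<open>2 / a ^ n\<close> of \<open>x\<close>.\<close>
  have q: "1 < 2 * (b - 1) / b" "2 * (b - 1) / b \<le> 2"
    using assms(2) by (auto simp: field_simps)
  have "infdist x (S n) < 2 * (b - 1) / b * infdist x (S n)"
    using mult_strict_right_mono[OF q(1) pos] by simp
  then obtain u where u: "u \<in> S n" "dist x u < 2 * (b - 1) / b * infdist x (S n)"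
    using infdist_near_point[OF ne] by blast
  have "infdist x (S n) \<ge> b / (2 * (b - 1)) * dist x u"
    using u(2) assms(2) by (simp add: field_simps)
  then have "f x - f u \<ge> (b - 2) / (2 * (b - 1)) * b ^ n * dist x u"
    by (rule TW_representation_growth[OF assms(1-3) u(1)])
  moreover have "dist x u < 2 / a ^ n"
    using u(2) mult_right_mono[OF q(2), of "infdist x (S n)"] pos le by simp
  moreover have "u \<noteq> x" using u(1) assms(4) by auto
  ultimately show thesis using that[of u] by (simp add: dist_commute)
qed

theorem theorem5p1:
  fixes a b :: real and f :: "'a::metric_space \<Rightarrow> real"
  assumes "a > b" and "b > 2"
    and "TW_function_monotonic a b f"
  shows "\<forall>x. \<not> x isolated_in UNIV \<longrightarrow> big_Lip f x = \<infinity>"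
proof (intro allI impI)
  fix x :: 'a
  assume iso: "\<not> x isolated_in UNIV"
  obtain S where S: "TW_representation a b S f" "incseq S"
    using assms(3) by (auto simp: TW_function_monotonic_def incseq_Suc_iff)
  show "big_Lip f x = \<infinity>"
  proof (rule big_Lip_eq_infinityI)
    fix C \<delta> :: real
    assume \<delta>: "\<delta> > 0"
    define c where "c = (b - 2) / (2 * (b - 1))"
    have c: "c > 0" using assms(2) by (simp add: c_def)
    obtain N1 where N1: "C / c < b ^ N1"
      using real_arch_pow[of b "C / c"] assms(2) by auto
    obtain N2 where N2: "2 / \<delta> < a ^ N2"
      using real_arch_pow[of a "2 / \<delta>"] assms(1,2) by auto
    have large: "C \<le> c * b ^ n" if "n \<ge> N1" for n
    proof -
      have "C / c \<le> b ^ n"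
        using N1 power_increasing[OF that, of b] assms(2) by linarith
      then show ?thesis using c by (simp add: field_simps)
    qed
    have small: "2 / a ^ n < \<delta>" if "n \<ge> N2" for n
    proof -
      have "2 / \<delta> < a ^ n"
        using N2 power_increasing[OF that, of a] assms(1,2) by linarith
      then show ?thesis using \<delta> assms(1,2) by (simp add: field_simps)
    qed
    have "\<exists>n u. n \<ge> N1 \<and> u \<noteq> x \<and> dist u x < \<delta> \<and> \<bar>f u - f x\<bar> \<ge> c * b ^ n * dist u x"
    proof (cases "\<exists>m. x \<in> S m")
      case True
      then obtain m where "x \<in> S m" by blast
      \<comment> \<open>Once in a level, \<open>x\<close> stays in all later ones, so the slope can
        be made as large as desired.\<close>
      then have "x \<in> S (max m N1)"
        using incseqD[OF S(2), of m "max m N1"] by auto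
      then show ?thesis
        using growth_points_in_level[OF S(1) assms(2) S(2) iso _ \<delta>] unfolding c_def
        by (metis max.cobounded2)
    next
      case False
      \<comment> \<open>Here \<open>N1\<close> makes the slope large and \<open>N2\<close> brings
        \<open>u\<close> within \<open>\<delta>\<close> of \<open>x\<close>.\<close>
      then show ?thesis
        using growth_points_off_level[OF S(1) assms(2) S(2), of x "max N1 N2"]
          small[of "max N1 N2"] unfolding c_def
        by (metis max.cobounded1 max.cobounded2 order_less_trans)
    qed
    then show "\<exists>u. u \<noteq> x \<and> dist u x < \<delta> \<and> \<bar>f u - f x\<bar> \<ge> C * dist u x"
      by (meson large mult_right_mono order_trans zero_le_dist)
  qed
qed

end
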